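(* Let $R \cong R_1 \times R_2 \times \cdots \times R_n$ with $n \ge 2$, where each $R_i$ is a local ring having a unique non-trivial (i.e. nonzero proper) ideal $\mathcal{M}_i$. Then $\mathrm{sdim}(\mathrm{PIS}(R)) = 3^n - n - 3$.
   Context: All rings are commutative with unity. The prime ideal sum graph $\mathrm{PIS}(R)$ is the simple undirected graph whose vertex set is the set of all nonzero proper ideals of $R$, with two distinct vertices $I$ and $J$ adjacent if and only if $I+J$ is a prime ideal of $R$. In a connected graph, a vertex $w$ strongly resolves vertices $u,v$ if some shortest $u$–$w$ path contains $v$ or some shortest $v$–$w$ path contains $u$. A set $S$ of vertices is a strong resolving set if every pair of distinct vertices is strongly resolved by some vertex of $S$; the strong metric dimension $\mathrm{sdim}$ is the minimum size of a strong resolving set. *)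

theory Defs
  imports
    "HOL-Algebra.Algebra"
    "Graph_Theory.Pair_Digraph"
    "Graph_Theory.Vertex_Walk"
begin

definition local_ring :: "('a, 'm) ring_scheme \<Rightarrow> bool" where
  "local_ring R \<longleftrightarrow> cring R \<and> (\<exists>!M. maximalideal M R)"

definition nontrivial_ideals :: "('a, 'm) ring_scheme \<Rightarrow> 'a set set" where
  "nontrivial_ideals R = {I. ideal I R \<and> I \<noteq> {\<zero>\<^bsub>R\<^esub>} \<and> I \<noteq> carrier R}"

text \<open>An undirected simple graph is represented by a digraph without loops that contains,
  with every arc, its reversal.  The arc relation below has both properties, since the sum of
  ideals is commutative.\<close>

definition PIS :: "('a, 'm) ring_scheme \<Rightarrow> 'a set pair_pre_digraph" where
  "PIS R = \<lparr> pverts = nontrivial_ideals R,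
             parcs = {(I, J). I \<in> nontrivial_ideals R \<and> J \<in> nontrivial_ideals R \<and> I \<noteq> J \<and>
                              primeideal (I <+>\<^bsub>R\<^esub> J) R} \<rparr>"

definition shortest_vpath :: "('v, 'e) pre_digraph \<Rightarrow> 'v \<Rightarrow> 'v vwalk \<Rightarrow> 'v \<Rightarrow> bool" where
  "shortest_vpath G u p v \<longleftrightarrow>
     vpath p G \<and> hd p = u \<and> last p = v \<and>
     (\<forall>q. vpath q G \<and> hd q = u \<and> last q = v \<longrightarrow> vwalk_length p \<le> vwalk_length q)"

definition strongly_resolves :: "('v, 'e) pre_digraph \<Rightarrow> 'v \<Rightarrow> 'v \<Rightarrow> 'v \<Rightarrow> bool" where
  "strongly_resolves G w u v \<longleftrightarrow>
     (\<exists>p. shortest_vpath G u p w \<and> v \<in> set p) \<or>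
     (\<exists>p. shortest_vpath G v p w \<and> u \<in> set p)"

definition strong_resolving_set :: "('v, 'e) pre_digraph \<Rightarrow> 'v set \<Rightarrow> bool" where
  "strong_resolving_set G S \<longleftrightarrow>
     S \<subseteq> verts G \<and>
     (\<forall>u\<in>verts G. \<forall>v\<in>verts G. u \<noteq> v \<longrightarrow> (\<exists>w\<in>S. strongly_resolves G w u v))"

text \<open>The finiteness condition excludes infinite sets, whose \<^const>\<open>card\<close> is \<open>0\<close>.  The value is
  meaningful only for a connected graph that has a finite strong resolving set.\<close>

definition sdim :: "('v, 'e) pre_digraph \<Rightarrow> nat" where
  "sdim G = (LEAST k. \<exists>S. strong_resolving_set G S \<and> finite S \<and> card S = k)"

end

theory Submission
  imports Defs
begin

text \<open>An ideal of the product is a vector over \<open>{0, 1, 2}\<close> (zero, \<open>M i\<close>, whole ring) and sums are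
  pointwise maxima.  Since 0 is not prime in a factor, the prime ideals are the vectors with one
  entry 1 and all others 2.  The graph has diameter 2, so two vertices outside a
  strong resolving set must be adjacent, and the complement of a clique whose vertices
  have distinct neighbours outside it is strongly resolving.
  The deficits \<open>{i. f i \<noteq> 2}\<close> of a clique pairwise meet in exactly one point, so by
  Fisher's inequality there are at most \<open>n\<close> of them; only a singleton deficit can occur twice.
  Hence a clique has at most \<open>n + 1\<close> of the \<open>3 ^ n - 2\<close> vertices.\<close>

section \<open>Strong metric dimension of graphs of diameter two\<close>

text \<open>Lying in a clique is necessary for unselected vertices but not sufficient: two adjacent
  unselected vertices with the same selected neighbours stay unresolved. So the largest clique has
  to be one whose members are told apart from outside. Its size exceeds Fisher's bound by one
  because a deficit forgets whether an entry is 0 or 1: the vectors with a single deficit coordinate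
  and entry 0 or 1 there are adjacent and share their deficit, whereas a repeated larger deficit
  would meet itself in several points. The value is (3^n - 2) - (n + 1).\<close>

lemma shortest_vpath_adjacent:
  assumes "u \<in> verts G" "v \<in> verts G" "u \<noteq> v" "(u, v) \<in> arcs_ends G"
  shows "shortest_vpath G u [u, v] v"
proof -
  have "length q \<ge> 2" if "vpath q G" "hd q = u" "last q = v" for q
    using that assms(3) by (cases q rule: vwalk_arcs.cases) (auto simp: vpath_def vwalk_def)
  moreover have "vpath [u, v] G"
    using assms by (auto simp: vpath_def vwalk_def)
  ultimately show ?thesis
    by (fastforce simp: shortest_vpath_def)
qed

lemma shortest_vpath_nonadjacent:
  assumes "u \<in> verts G" "v \<in> verts G" "w \<in> verts G" "u \<noteq> v" "(u, v) \<notin> arcs_ends G"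
    and "(u, w) \<in> arcs_ends G" "(w, v) \<in> arcs_ends G"
  shows "shortest_vpath G u [u, w, v] v"
proof -
  have "length q \<ge> 3" if q: "vpath q G" "hd q = u" "last q = v" for q
  proof (cases q rule: vwalk_arcs.cases)
    case (3 x y xs)
    then show ?thesis
      using q assms(5) by (cases xs) (auto simp: vpath_def vwalk_def)
  qed (use q assms(4) in \<open>auto simp: vpath_def vwalk_def\<close>)
  moreover have "w \<noteq> u" "w \<noteq> v"
    using assms by auto
  then have "vpath [u, w, v] G"
    using assms by (auto simp: vpath_def vwalk_def)
  ultimately show ?thesis
    by (fastforce simp: shortest_vpath_def)
qed

text \<open>Isolates what the computation of \<open>sdim\<close> uses about the graph.
  \<open>common_neighbour\<close> bounds all distances by 2 and so also gives connectedness.\<close>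

locale diameter_two =
  fixes G :: "('v, 'e) pre_digraph"
  assumes finite_verts: "finite (verts G)"
    and sym_arcs: "(u, v) \<in> arcs_ends G \<Longrightarrow> (v, u) \<in> arcs_ends G"
    and common_neighbour:
      "\<lbrakk>u \<in> verts G; v \<in> verts G; u \<noteq> v; (u, v) \<notin> arcs_ends G\<rbrakk>
        \<Longrightarrow> \<exists>w\<in>verts G. (u, w) \<in> arcs_ends G \<and> (w, v) \<in> arcs_ends G"
begin

definition clique :: "'v set \<Rightarrow> bool" where
  "clique K \<longleftrightarrow> K \<subseteq> verts G \<and> (\<forall>u\<in>K. \<forall>v\<in>K. u \<noteq> v \<longrightarrow> (u, v) \<in> arcs_ends G)"

lemma ex_shortest_vpath:
  assumes "u \<in> verts G" "v \<in> verts G" "u \<noteq> v"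
  shows "\<exists>p. shortest_vpath G u p v \<and> u \<in> set p \<and> v \<in> set p \<and> length p \<le> 3"
proof (cases "(u, v) \<in> arcs_ends G")
  case True
  then show ?thesis
    using shortest_vpath_adjacent[OF assms] by (intro exI[of _ "[u, v]"]) simp
next
  case False
  then obtain w where "w \<in> verts G" "(u, w) \<in> arcs_ends G" "(w, v) \<in> arcs_ends G"
    using common_neighbour assms by blast
  then show ?thesis
    using shortest_vpath_nonadjacent assms False by (intro exI[of _ "[u, w, v]"]) simp
qed

text \<open>Distances are at most 2, so a shortest path has at most three vertices and its only
  possible inner vertex is the middle one, a neighbour of both ends.\<close>

lemma adjacent_if_inner_vertex:
  assumes "u \<in> verts G" "w \<in> verts G" "u \<noteq> w"
    and p: "shortest_vpath G u p w" and v: "v \<in> set p" "v \<noteq> u" "v \<noteq> w"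
  shows "(u, v) \<in> arcs_ends G"
proof -
  obtain q where q: "shortest_vpath G u q w" "length q \<le> 3"
    using ex_shortest_vpath[OF assms(1-3)] by blast
  have "vwalk_length p \<le> vwalk_length q"
    using p q(1) unfolding shortest_vpath_def by blast
  then have len: "length p \<le> 3"
    using q(2) by simp
  have "hd p = u" "last p = w" "vwalk p G"
    using p unfolding shortest_vpath_def vpath_def by blast+
  have "p = [u, v, w]"
  proof (cases p rule: vwalk_arcs.cases)
    case 1
    then show ?thesis using v by simp
  next
    case (2 x)
    then show ?thesis using v \<open>hd p = u\<close> by simp
  next
    case (3 x y xs)
    then consider "xs = []" | z where "xs = [z]"
      using len by (cases xs) auto
    then show ?thesis
      by cases (use 3 \<open>hd p = u\<close> \<open>last p = w\<close> v in auto)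
  qed
  then show ?thesis
    using \<open>vwalk p G\<close> by (simp add: vwalk_def)
qed

text \<open>A resolving vertex \<open>w\<close> in \<open>S\<close> differs from the unselected
  \<open>u\<close> and \<open>v\<close>. Hence one of these is an inner vertex of a shortest path
  from the other to \<open>w\<close>, which makes them adjacent.\<close>

lemma clique_complement:
  assumes "strong_resolving_set G S"
  shows "clique (verts G - S)"
  unfolding clique_def
proof (intro conjI ballI impI)
  fix u v assume uv: "u \<in> verts G - S" "v \<in> verts G - S" "u \<noteq> v"
  then obtain w where w: "w \<in> S" "strongly_resolves G w u v"
    using assms unfolding strong_resolving_set_def by blast
  then have "w \<in> verts G" "w \<noteq> u" "w \<noteq> v"
    using assms uv unfolding strong_resolving_set_def by auto
  then have "(u, v) \<in> arcs_ends G \<or> (v, u) \<in> arcs_ends G"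
    using w(2) uv adjacent_if_inner_vertex[of u w _ v] adjacent_if_inner_vertex[of v w _ u]
    unfolding strongly_resolves_def by blast
  then show "(u, v) \<in> arcs_ends G"
    using sym_arcs by blast
qed auto

text \<open>A shortest path contains both its ends, so a pair is resolved by either of its members.
  Only pairs avoiding the chosen set need an argument.\<close>

lemma strongly_resolves_end:
  assumes "u \<in> verts G" "v \<in> verts G" "u \<noteq> v"
  shows "strongly_resolves G u u v" "strongly_resolves G v u v"
  using ex_shortest_vpath[OF assms] ex_shortest_vpath[OF assms(2,1) assms(3)[symmetric]]
  unfolding strongly_resolves_def by blast+

text \<open>If \<open>w\<close> is adjacent to \<open>v\<close> but not to \<open>u\<close>, then
  \<open>u\<close>, \<open>v\<close>, \<open>w\<close> is a shortest path, because \<open>u\<close>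
  and \<open>v\<close> are adjacent in the clique. The other case is symmetric.\<close>

lemma strong_resolving_set_clique_complement:
  assumes C: "clique C"
    and sep: "\<And>u v. \<lbrakk>u \<in> C; v \<in> C; u \<noteq> v\<rbrakk>
      \<Longrightarrow> \<exists>w\<in>verts G - C. (u, w) \<in> arcs_ends G \<longleftrightarrow> (v, w) \<notin> arcs_ends G"
  shows "strong_resolving_set G (verts G - C)"
  unfolding strong_resolving_set_def
proof (intro conjI ballI impI)
  fix u v assume uv: "u \<in> verts G" "v \<in> verts G" "u \<noteq> v"
  show "\<exists>w\<in>verts G - C. strongly_resolves G w u v"
  proof (cases "u \<in> C \<and> v \<in> C")
    case False
    then show ?thesis
      using uv strongly_resolves_end[OF uv] by blast
  next
    case True
    then obtain w where w: "w \<in> verts G - C" "(u, w) \<in> arcs_ends G \<longleftrightarrow> (v, w) \<notin> arcs_ends G"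
      using sep uv by blast
    have arc: "(u, v) \<in> arcs_ends G" "(v, u) \<in> arcs_ends G"
      using True C uv unfolding clique_def by auto
    have "w \<noteq> u" "w \<noteq> v"
      using True w by auto
    then have "shortest_vpath G u [u, v, w] w \<or> shortest_vpath G v [v, u, w] w"
      using shortest_vpath_nonadjacent[of u G w v] shortest_vpath_nonadjacent[of v G w u] uv w arc
      by blast
    then show ?thesis
      using w(1) unfolding strongly_resolves_def by fastforce
  qed
qed auto

lemma sdim_eq:
  assumes C: "clique C"
    and max: "\<And>K. clique K \<Longrightarrow> card K \<le> card C"
    and sep: "\<And>u v. \<lbrakk>u \<in> C; v \<in> C; u \<noteq> v\<rbrakk>
      \<Longrightarrow> \<exists>w\<in>verts G - C. (u, w) \<in> arcs_ends G \<longleftrightarrow> (v, w) \<notin> arcs_ends G"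
  shows "sdim G = card (verts G) - card C"
  unfolding sdim_def
proof (rule Least_equality)
  have "C \<subseteq> verts G"
    using C unfolding clique_def by blast
  then have "card (verts G - C) = card (verts G) - card C"
    using finite_verts by (simp add: card_Diff_subset finite_subset)
  then show "\<exists>S. strong_resolving_set G S \<and> finite S \<and> card S = card (verts G) - card C"
    using strong_resolving_set_clique_complement[OF C sep] finite_verts by blast
next
  fix k assume "\<exists>S. strong_resolving_set G S \<and> finite S \<and> card S = k"
  then obtain S where S: "strong_resolving_set G S" "finite S" "card S = k"
    by blast
  then have "card (verts G) - k \<le> card C"
    using max[OF clique_complement[OF S(1)]] diff_card_le_card_Diff[OF S(2), of "verts G"] by simp
  then show "card (verts G) - card C \<le> k"
    by simp
qed

end

section \<open>Fisher's inequality\<close>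

text \<open>Gaussian elimination, one coordinate of \<open>P\<close> per induction step. Vectors are
  indexed by \<open>F\<close>, so equal vectors under different indices cause no trouble.\<close>

lemma ex_linear_dependence:
  fixes a :: "'i \<Rightarrow> 'x \<Rightarrow> real"
  assumes "finite P" "finite F" "card P < card F"
  shows "\<exists>c. (\<exists>d\<in>F. c d \<noteq> 0) \<and> (\<forall>x\<in>P. (\<Sum>d\<in>F. c d * a d x) = 0)"
  using assms
proof (induction P arbitrary: F a rule: finite_induct)
  case empty
  then have "F \<noteq> {}" by auto
  then show ?case by (intro exI[of _ "\<lambda>_. 1"]) auto
next
  case (insert x P)
  show ?case
  proof (cases "\<forall>d\<in>F. a d x = 0")
    case True
    then show ?thesis
      using insert.IH[of F a] insert.prems insert.hyps by auto
  next
    case False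
    then obtain e where e: "e \<in> F" "a e x \<noteq> 0"
      by blast
    \<comment> \<open>Subtracting a multiple of the pivot vector \<open>e\<close> makes coordinate
      \<open>x\<close> vanish in every remaining vector.\<close>
    define b where "b d y = a d y - a d x / a e x * a e y" for d y
    have "card P < card (F - {e})"
      using insert e by auto
    then obtain c where c: "\<exists>d\<in>F - {e}. c d \<noteq> 0" "\<forall>y\<in>P. (\<Sum>d\<in>F - {e}. c d * b d y) = 0"
      using insert.IH[of "F - {e}" b] insert.prems by auto
    \<comment> \<open>The coefficient of \<open>e\<close> collects the subtracted multiples, so that
      the \<open>a\<close>-combination over \<open>F\<close> equals the \<open>b\<close>-combination
      over \<open>F - {e}\<close>.\<close>
    define r where "r = (\<Sum>d\<in>F - {e}. c d * (a d x / a e x))"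
    define c' where "c' = c(e := - r)"
    have sum: "(\<Sum>d\<in>F. c' d * a d y) = (\<Sum>d\<in>F - {e}. c d * b d y)" for y
    proof -
      have "(\<Sum>d\<in>F. c' d * a d y) = - r * a e y + (\<Sum>d\<in>F - {e}. c' d * a d y)"
        using e insert.prems by (simp add: sum.remove c'_def)
      also have "(\<Sum>d\<in>F - {e}. c' d * a d y) = (\<Sum>d\<in>F - {e}. c d * a d y)"
        by (rule sum.cong) (auto simp: c'_def)
      also have "- r * a e y + \<dots> = (\<Sum>d\<in>F - {e}. c d * b d y)"
        unfolding r_def b_def
        by (simp add: sum_distrib_right right_diff_distrib sum_subtractf mult.assoc)
      finally show ?thesis .
    qed
    have "b d x = 0" for d
      using e by (simp add: b_def)
    then have "\<forall>y\<in>insert x P. (\<Sum>d\<in>F. c' d * a d y) = 0"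
      using c(2) by (simp add: sum)
    moreover have "\<exists>d\<in>F. c' d \<noteq> 0"
      using c(1) by (auto simp: c'_def)
    ultimately show ?thesis by blast
  qed
qed

text \<open>A linear dependence \<open>c\<close> of the incidence vectors would satisfy
  \<open>0 = (\<Sum>d. c d)\<^sup>2 + (\<Sum>d. (c d)\<^sup>2 (card (D d) - 1))\<close>.\<close>

lemma fisher_inequality:
  fixes D :: "'i \<Rightarrow> 'x set"
  assumes "finite P" "finite F"
    and sub: "\<And>d. d \<in> F \<Longrightarrow> D d \<subseteq> P"
    and nonempty: "\<And>d. d \<in> F \<Longrightarrow> D d \<noteq> {}"
    and meet: "\<And>d e. \<lbrakk>d \<in> F; e \<in> F; d \<noteq> e\<rbrakk> \<Longrightarrow> card (D d \<inter> D e) = 1"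
    and singleton: "\<And>d e. \<lbrakk>d \<in> F; e \<in> F; card (D d) = 1; card (D e) = 1\<rbrakk> \<Longrightarrow> d = e"
  shows "card F \<le> card P"
proof (rule ccontr)
  assume "\<not> card F \<le> card P"
  then obtain c where c: "\<exists>d\<in>F. c d \<noteq> 0"
    "\<forall>x\<in>P. (\<Sum>d\<in>F. c d * (of_bool (x \<in> D d) :: real)) = 0"
    using ex_linear_dependence[OF assms(1,2), of "\<lambda>d x. of_bool (x \<in> D d)"] by auto
  have fin: "finite (D d)" if "d \<in> F" for d
    using sub[OF that] assms(1) by (rule finite_subset)
  have pos: "card (D d) \<ge> 1" if "d \<in> F" for d
    using fin[OF that] nonempty[OF that] by (simp add: Suc_leI card_gt_0_iff)
  \<comment> \<open>The Gram matrix is written as all ones plus a diagonal: the ones contribute the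
    square of the coefficient sum, the diagonal a nonnegative remainder.\<close>
  have inner: "(\<Sum>x\<in>P. of_bool (x \<in> D d) * (of_bool (x \<in> D e) :: real))
      = 1 + (if d = e then real (card (D d)) - 1 else 0)" if "d \<in> F" "e \<in> F" for d e
  proof -
    have "(\<Sum>x\<in>P. of_bool (x \<in> D d) * (of_bool (x \<in> D e) :: real))
        = (\<Sum>x\<in>P. of_bool (x \<in> D d \<inter> D e))"
      by (rule sum.cong) auto
    also have "\<dots> = card (P \<inter> (D d \<inter> D e))"
      using assms(1) by (simp add: Int_def)
    also have "P \<inter> (D d \<inter> D e) = D d \<inter> D e"
      using sub that by blast
    finally show ?thesis
      using meet[OF that] by auto
  qed
  have "0 = (\<Sum>x\<in>P. (\<Sum>d\<in>F. c d * of_bool (x \<in> D d)) * (\<Sum>e\<in>F. c e * of_bool (x \<in> D e)))"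
    using c(2) by simp
  also have "\<dots> = (\<Sum>x\<in>P. \<Sum>d\<in>F. \<Sum>e\<in>F. c d * c e * (of_bool (x \<in> D d) * of_bool (x \<in> D e)))"
    by (simp add: sum_product mult_ac)
  also have "\<dots> = (\<Sum>d\<in>F. \<Sum>e\<in>F. \<Sum>x\<in>P. c d * c e * (of_bool (x \<in> D d) * of_bool (x \<in> D e)))"
    by (subst sum.swap, rule sum.cong[OF refl], rule sum.swap)
  also have "\<dots> = (\<Sum>d\<in>F. \<Sum>e\<in>F. c d * c e * (1 + (if d = e then real (card (D d)) - 1 else 0)))"
    by (intro sum.cong refl) (simp add: inner flip: sum_distrib_left)
  also have "\<dots> = (\<Sum>d\<in>F. \<Sum>e\<in>F. c d * c e) + (\<Sum>d\<in>F. (c d)\<^sup>2 * (real (card (D d)) - 1))"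
    using assms(2)
    by (simp add: distrib_left sum.distrib if_distrib[of "\<lambda>t. _ * t"] power2_eq_square cong: if_cong)
  also have "(\<Sum>d\<in>F. \<Sum>e\<in>F. c d * c e) = (\<Sum>d\<in>F. c d)\<^sup>2"
    by (simp add: power2_eq_square sum_product)
  finally have eq: "(\<Sum>d\<in>F. c d)\<^sup>2 + (\<Sum>d\<in>F. (c d)\<^sup>2 * (real (card (D d)) - 1)) = 0"
    by simp
  have nonneg: "(c d)\<^sup>2 * (real (card (D d)) - 1) \<ge> 0" if "d \<in> F" for d
    using pos[OF that] by simp
  then have "(\<Sum>d\<in>F. (c d)\<^sup>2 * (real (card (D d)) - 1)) \<ge> 0"
    by (rule sum_nonneg)
  then have zero: "(\<Sum>d\<in>F. c d) = 0" "(\<Sum>d\<in>F. (c d)\<^sup>2 * (real (card (D d)) - 1)) = 0"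
    using eq add_nonneg_eq_0_iff[OF zero_le_power2[of "\<Sum>d\<in>F. c d"]] by simp_all
  \<comment> \<open>A nonzero coefficient forces a one-element set, and there is at most one such
    index. So exactly one coefficient is nonzero, which contradicts the vanishing of the coefficient
    sum.\<close>
  have card1: "card (D d) = 1" if "d \<in> F" "c d \<noteq> 0" for d
    using sum_nonneg_0[OF assms(2) nonneg zero(2) that(1)] that(2) by auto
  obtain d where d: "d \<in> F" "c d \<noteq> 0"
    using c(1) by blast
  have "c e = 0" if "e \<in> F - {d}" for e
    using card1 d singleton that by blast
  then have "(\<Sum>e\<in>F. c e) = c d"
    using d assms(2) by (simp add: sum.remove)
  then show False
    using d zero(1) by simp
qed

section \<open>The graph on vectors over \<open>{0, 1, 2}\<close>\<close>

text \<open>The functions are extensional, so each vector is represented once: equality can be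
  tested on coordinates below \<open>n\<close>, and the cardinality is exactly 3^n.\<close>

definition codes :: "nat \<Rightarrow> (nat \<Rightarrow> nat) set" where
  "codes n = {..<n} \<rightarrow>\<^sub>E {..2}"

definition proper_codes :: "nat \<Rightarrow> (nat \<Rightarrow> nat) set" where
  "proper_codes n = {f \<in> codes n. (\<exists>i<n. f i \<noteq> 0) \<and> (\<exists>i<n. f i \<noteq> 2)}"

definition prime_code :: "nat \<Rightarrow> (nat \<Rightarrow> nat) \<Rightarrow> bool" where
  "prime_code n f \<longleftrightarrow> (\<exists>i<n. f i = 1 \<and> (\<forall>j<n. j \<noteq> i \<longrightarrow> f j = 2))"

definition code_adj :: "nat \<Rightarrow> (nat \<Rightarrow> nat) \<Rightarrow> (nat \<Rightarrow> nat) \<Rightarrow> bool" where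
  "code_adj n f g \<longleftrightarrow> f \<noteq> g \<and> prime_code n (\<lambda>i. max (f i) (g i))"

text \<open>Under the correspondence with ideals, coordinate \<open>i\<close> stands for the maximal
  ideal with \<open>M i\<close> in factor \<open>i\<close>. The deficit thus records which maximal
  ideals contain the given ideal.\<close>

definition deficit :: "nat \<Rightarrow> (nat \<Rightarrow> nat) \<Rightarrow> nat set" where
  "deficit n f = {i. i < n \<and> f i \<noteq> 2}"

lemma code_adj_sym: "code_adj n f g \<Longrightarrow> code_adj n g f"
  by (auto simp: code_adj_def max.commute)

lemma codes_le: "f \<in> codes n \<Longrightarrow> i < n \<Longrightarrow> f i \<le> 2"
  by (auto simp: codes_def)

lemma codes_eqI: "\<lbrakk>f \<in> codes n; g \<in> codes n; \<And>i. i < n \<Longrightarrow> f i = g i\<rbrakk> \<Longrightarrow> f = g"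
  by (auto simp: codes_def intro: PiE_ext)

lemma finite_codes: "finite (codes n)"
  by (auto simp: codes_def intro: finite_PiE)

lemma card_proper_codes:
  assumes "n \<ge> 1"
  shows "card (proper_codes n) = 3 ^ n - 2"
proof -
  let ?const = "\<lambda>k. restrict (\<lambda>_. k) {..<n} :: nat \<Rightarrow> nat"
  have const: "?const k \<in> codes n" if "k \<le> 2" for k
    using that by (auto simp: codes_def)
  have "proper_codes n = codes n - {?const 0, ?const 2}"
  proof (intro equalityI subsetI)
    fix f assume "f \<in> codes n - {?const 0, ?const 2}"
    then show "f \<in> proper_codes n"
      using codes_eqI[of f n "?const 0"] codes_eqI[of f n "?const 2"] const
      by (auto simp: proper_codes_def)
  qed (auto simp: proper_codes_def)
  moreover have "?const 0 0 \<noteq> ?const 2 0"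
    using assms by simp
  then have "?const 0 \<noteq> ?const 2"
    by metis
  moreover have "card (codes n) = 3 ^ n"
    by (simp add: codes_def card_PiE)
  ultimately show ?thesis
    using const by (simp add: card_Diff_subset)
qed

text \<open>The maximum is below 2 exactly where both entries are. The value 1 at the common
  coordinate is kept because it excludes two zeros there, which the deficits cannot see.\<close>

lemma code_adjD:
  assumes "f \<in> codes n" "g \<in> codes n" "code_adj n f g"
  obtains i where "i < n" "deficit n f \<inter> deficit n g = {i}" "max (f i) (g i) = 1"
proof -
  obtain i where i: "i < n" "max (f i) (g i) = 1" "\<And>j. j < n \<Longrightarrow> j \<noteq> i \<Longrightarrow> max (f j) (g j) = 2"
    using assms by (auto simp: code_adj_def prime_code_def)
  have "deficit n f \<inter> deficit n g = {i}"
  proof (intro equalityI subsetI)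
    fix j assume "j \<in> deficit n f \<inter> deficit n g"
    then show "j \<in> {i}"
      using i(3)[of j] unfolding max_def by (cases "f j \<le> g j") (auto simp: deficit_def)
  qed (use i in \<open>auto simp: deficit_def\<close>)
  then show ?thesis using that i by blast
qed

lemma code_adjI:
  assumes "f \<in> codes n" "g \<in> codes n" "f \<noteq> g" "i < n"
    and "max (f i) (g i) = 1" "\<And>j. j < n \<Longrightarrow> j \<noteq> i \<Longrightarrow> f j = 2 \<or> g j = 2"
  shows "code_adj n f g"
proof -
  have "max (f j) (g j) = 2" if "j < n" "j \<noteq> i" for j
    using assms(6)[OF that] codes_le[OF assms(1) that(1)] codes_le[OF assms(2) that(1)] by auto
  then show ?thesis
    using assms(3-5) by (auto simp: code_adj_def prime_code_def)
qed

lemma code_clique_bound: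
  assumes "K \<subseteq> proper_codes n"
    and adj: "\<And>f g. \<lbrakk>f \<in> K; g \<in> K; f \<noteq> g\<rbrakk> \<Longrightarrow> code_adj n f g"
  shows "card K \<le> n + 1"
proof -
  have codes: "f \<in> codes n" if "f \<in> K" for f
    using that assms(1) by (auto simp: proper_codes_def)
  have fin: "finite K"
    using finite_subset[OF _ finite_codes[of n]] codes by blast
  \<comment> \<open>Fisher's inequality allows only one singleton. \<open>Z\<close> holds the
    singleton deficits with entry 0; two of them would have maximum 0, not 1, at their common
    coordinate, so at most one vector is set aside.\<close>
  define Z where "Z = {f \<in> K. \<exists>i. deficit n f = {i} \<and> f i = 0}"
  have "f = g" if "f \<in> Z" "g \<in> Z" for f g
  proof (rule ccontr)
    assume "f \<noteq> g"
    moreover have "f \<in> K" "g \<in> K"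
      using that by (auto simp: Z_def)
    ultimately obtain i where "deficit n f \<inter> deficit n g = {i}" "max (f i) (g i) = 1"
      by (meson code_adjD adj codes)
    moreover from this have "i \<in> deficit n f" "i \<in> deficit n g"
      by auto
    ultimately show False
      using that by (auto simp: Z_def)
  qed
  then have cardZ: "card Z \<le> 1"
    using card_le_Suc0_iff_eq[of Z] fin by (simp add: Z_def)
  have "card (K - Z) \<le> card {..<n}"
  proof (rule fisher_inequality[where D = "deficit n"])
    fix f g assume fg: "f \<in> K - Z" "g \<in> K - Z"
    then have fgc: "f \<in> codes n" "g \<in> codes n"
      using codes by blast+
    have meet: "\<exists>i. deficit n f \<inter> deficit n g = {i}" if "f \<noteq> g"
      using code_adjD[OF fgc adj[of f g]] fg that by blast
    then show "card (deficit n f \<inter> deficit n g) = 1" if "f \<noteq> g"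
      using that by auto
    assume "card (deficit n f) = 1" "card (deficit n g) = 1"
    then obtain i j where ij: "deficit n f = {i}" "deficit n g = {j}"
      by (auto simp: card_1_singleton_iff)
    \<comment> \<open>Distinct members would have meeting deficits, hence the same singleton.
      Outside \<open>Z\<close> the entry there is neither 0 nor 2, so both entries are 1 and the
      vectors agree.\<close>
    show "f = g"
    proof (rule ccontr)
      assume ne: "f \<noteq> g"
      then have "i = j"
        using meet ij by (cases "i = j") auto
      have "f i \<noteq> 0" "g i \<noteq> 0" "f i \<noteq> 2" "g i \<noteq> 2" "i < n"
        using fg ij \<open>i = j\<close> by (auto simp: Z_def deficit_def)
      moreover have "f i \<le> 2" "g i \<le> 2"
        using codes_le[OF fgc(1) \<open>i < n\<close>] codes_le[OF fgc(2) \<open>i < n\<close>] .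
      moreover have "f k = 2 \<and> g k = 2" if "k < n" "k \<noteq> i" for k
        using ij \<open>i = j\<close> that by (auto simp: deficit_def)
      ultimately have "f k = g k" if "k < n" for k
        using that by (cases "k = i") auto
      then show False
        using ne codes_eqI[OF fgc] by blast
    qed
  next
    fix f assume "f \<in> K - Z"
    then show "deficit n f \<noteq> {}"
      using assms(1) by (auto simp: proper_codes_def deficit_def)
  qed (use fin in \<open>auto simp: deficit_def\<close>)
  moreover have "K = (K - Z) \<union> Z"
    by (auto simp: Z_def)
  then have "card K \<le> card (K - Z) + card Z"
    by (metis card_Un_le)
  ultimately show ?thesis
    using cardZ by simp
qed

section \<open>Common neighbours and a largest clique\<close>

definition mk_code :: "nat \<Rightarrow> (nat \<Rightarrow> nat) \<Rightarrow> nat \<Rightarrow> nat" where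
  "mk_code n h = (\<lambda>i. if i < n then h i else undefined)"

lemma mk_code_simps [simp]: "i < n \<Longrightarrow> mk_code n h i = h i"
  by (simp add: mk_code_def)

lemma mk_code_in_codes: "(\<And>i. i < n \<Longrightarrow> h i \<le> 2) \<Longrightarrow> mk_code n h \<in> codes n"
  by (auto simp: mk_code_def codes_def split: if_splits)

lemma code_common_neighbour:
  assumes "n \<ge> 2" and f: "f \<in> proper_codes n" and g: "g \<in> proper_codes n"
    and "f \<noteq> g" "\<not> code_adj n f g"
  shows "\<exists>h\<in>proper_codes n. code_adj n f h \<and> code_adj n h g"
proof -
  \<comment> \<open>A common deficit coordinate is taken whenever one exists. If \<open>i\<close>
    and \<open>j\<close> differ, the deficits are therefore disjoint, and \<open>{i, j}\<close>
    meets each of them in exactly one point.\<close>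
  obtain i j where i: "i < n" "f i \<noteq> 2" and j: "j < n" "g j \<noteq> 2"
    and ij: "(\<exists>k<n. f k \<noteq> 2 \<and> g k \<noteq> 2) \<Longrightarrow> i = j"
  proof (cases "\<exists>k<n. f k \<noteq> 2 \<and> g k \<noteq> 2")
    case True
    then show ?thesis using that by blast
  next
    case False
    moreover obtain i j where "i < n" "f i \<noteq> 2" "j < n" "g j \<noteq> 2"
      using f g unfolding proper_codes_def mem_Collect_eq by blast
    ultimately show ?thesis using that[of i j] by blast
  qed
  have fg: "f \<in> codes n" "g \<in> codes n"
    using f g by (auto simp: proper_codes_def)
  have fi: "f i \<le> 1" "g j \<le> 1"
    using codes_le[OF fg(1) i(1)] codes_le[OF fg(2) j(1)] i j by auto
  have ne: "f j = 2" "g i = 2" if "i \<noteq> j"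
    using ij i j that by blast+
  define h where "h = mk_code n (\<lambda>k. if k = i \<or> k = j then 1 else 2)"
  have h: "h \<in> codes n" "h \<in> proper_codes n"
    using i by (auto simp: h_def proper_codes_def intro!: mk_code_in_codes exI[of _ i])
  have hk: "h k = (if k = i \<or> k = j then 1 else 2)" if "k < n" for k
    using that by (simp add: h_def)
  have "code_adj n f h" if "f \<noteq> h"
  proof (rule code_adjI[OF fg(1) h(1) that i(1)])
    show "max (f i) (h i) = 1"
      using fi(1) hk[OF i(1)] by simp
    show "f k = 2 \<or> h k = 2" if "k < n" "k \<noteq> i" for k
      using that hk[OF that(1)] ne(1) by (cases "k = j") auto
  qed
  moreover have "code_adj n h g" if "h \<noteq> g"
  proof (rule code_adjI[OF h(1) fg(2) that j(1)])
    show "max (h j) (g j) = 1"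
      using fi(2) hk[OF j(1)] by simp
    show "h k = 2 \<or> g k = 2" if "k < n" "k \<noteq> j" for k
      using that hk[OF that(1)] ne(2) by (cases "k = i") auto
  qed
  \<comment> \<open>If \<open>h\<close> coincided with \<open>f\<close> or \<open>g\<close>, the
    remaining adjacency would make \<open>f\<close> and \<open>g\<close> adjacent, against the
    assumption.\<close>
  ultimately show ?thesis
    using h(2) assms(4,5) by blast
qed

text \<open>The extremal clique: \<open>star_code n 0\<close> is the prime ideal with deficit in coordinate 0 only,
  \<open>star_code n n\<close> is the product with factor 0 there, and the others have deficit \<open>{0, j}\<close>.\<close>

definition star_code :: "nat \<Rightarrow> nat \<Rightarrow> nat \<Rightarrow> nat" where
  "star_code n j = mk_code n (\<lambda>i. if i = 0 then (if j = n then 0 else 1) else if i = j then 1 else 2)"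

lemma star_code_in_codes: "star_code n j \<in> codes n"
  unfolding star_code_def by (rule mk_code_in_codes) auto

lemma star_code_proper:
  assumes "n \<ge> 2"
  shows "star_code n j \<in> proper_codes n"
proof -
  have "star_code n j 1 \<noteq> 0" "star_code n j 0 \<noteq> 2"
    using assms by (auto simp: star_code_def)
  moreover have "1 < n" "0 < n"
    using assms by auto
  ultimately show ?thesis
    using star_code_in_codes[of n j] unfolding proper_codes_def by blast
qed

lemma star_code_nth:
  "i < n \<Longrightarrow> star_code n j i = (if i = 0 then (if j = n then 0 else 1) else if i = j then 1 else 2)"
  by (simp add: star_code_def)

lemma star_code_neq:
  assumes "n \<ge> 2" "j \<le> n" "k \<le> n" "j \<noteq> k"
  shows "star_code n j \<noteq> star_code n k"
proof -
  have "\<exists>i<n. star_code n j i \<noteq> star_code n k i"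
  proof (cases "j = n \<or> k = n")
    case True
    then have "star_code n j 0 \<noteq> star_code n k 0"
      using assms by (auto simp: star_code_nth)
    then show ?thesis
      using assms(1) by (intro exI[of _ 0]) simp
  next
    case False
    define i where "i = (if j = 0 then k else j)"
    have "i < n" "i \<noteq> 0" "i = j \<and> i \<noteq> k \<or> i = k \<and> i \<noteq> j"
      using False assms by (auto simp: i_def)
    then show ?thesis
      by (intro exI[of _ i]) (auto simp: star_code_nth)
  qed
  then show ?thesis by metis
qed

text \<open>Distinct members of the star share only coordinate 0 in their deficits, and only index
  \<open>n\<close> has entry 0 there, so the maximum is 1.\<close>

lemma star_code_adj:
  assumes "n \<ge> 2" "j \<le> n" "k \<le> n" "j \<noteq> k"
  shows "code_adj n (star_code n j) (star_code n k)"
proof (rule code_adjI[where i = 0, OF star_code_in_codes star_code_in_codes])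
  show "star_code n j \<noteq> star_code n k"
    by (rule star_code_neq[OF assms])
qed (use assms in \<open>auto simp: star_code_nth\<close>)

text \<open>For \<open>0 < m < n\<close>, the maximal ideal at coordinate \<open>m\<close> is
  adjacent to the member with index \<open>m\<close> and to no other. Only indices 0 and
  \<open>n\<close> are left; they have the same deficit, so their separation must exploit the entry
  at coordinate 0.\<close>

lemma star_code_separated:
  assumes "n \<ge> 2" "j \<le> n" "k \<le> n" "j \<noteq> k"
  shows "\<exists>h\<in>proper_codes n - star_code n ` {..n}.
    code_adj n (star_code n j) h \<longleftrightarrow> \<not> code_adj n (star_code n k) h"
proof -
  have interior: "\<exists>h\<in>proper_codes n - star_code n ` {..n}.
      code_adj n (star_code n m) h \<and> \<not> code_adj n (star_code n l) h"
    if "0 < m" "m < n" "l \<noteq> m" for m l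
  proof -
    define h where "h = mk_code n (\<lambda>i. if i = m then 1 else 2)"
    have hk: "h i = (if i = m then 1 else 2)" if "i < n" for i
      using that by (simp add: h_def)
    have h: "h \<in> codes n"
      unfolding h_def by (rule mk_code_in_codes) auto
    \<comment> \<open>Every star vector is at most 1 at coordinate 0, where \<open>h\<close> is
      2.\<close>
    have h0: "star_code n i 0 \<noteq> h 0" for i
      using assms(1) that hk[of 0] by (simp add: star_code_nth)
    then have ne: "star_code n i \<noteq> h" for i
      by metis
    then have "h \<notin> star_code n ` {..n}"
      by blast
    moreover have "h \<in> proper_codes n"
      using h hk that by (auto simp: proper_codes_def intro!: exI[of _ m])
    moreover have "code_adj n (star_code n m) h"
      using that by (intro code_adjI[where i = m] star_code_in_codes h ne)
        (auto simp: hk star_code_nth)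
    moreover have "max (star_code n l i) (h i) = 2" if "i < n" for i
      using that \<open>l \<noteq> m\<close> \<open>0 < m\<close> by (auto simp: hk star_code_nth)
    then have "\<not> code_adj n (star_code n l) h"
      by (auto simp: code_adj_def prime_code_def)
    ultimately show ?thesis by blast
  qed
  \<comment> \<open>The entry 0 at coordinate 0 leaves the maximum to the star vector: 1 for index 0
    but 0 for index \<open>n\<close>. The entry 1 at coordinate 1, available as \<open>n\<close> is
    at least 2, keeps \<open>h\<close> outside the star.\<close>
  define h where "h = mk_code n (\<lambda>i. if i = 0 then 0 else if i = 1 then 1 else 2)"
  have ends: "h \<in> proper_codes n - star_code n ` {..n}"
    "code_adj n (star_code n 0) h" "\<not> code_adj n (star_code n n) h"
  proof -
    have hk: "h i = (if i = 0 then 0 else if i = 1 then 1 else 2)" if "i < n" for i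
      using that by (simp add: h_def)
    have h: "h \<in> codes n"
      unfolding h_def by (rule mk_code_in_codes) auto
    have ne: "star_code n i \<noteq> h" for i
    proof
      assume "star_code n i = h"
      then have "star_code n i 0 = 0" "star_code n i 1 = 1"
        using hk assms(1) by auto
      then show False
        using assms(1) by (auto simp: star_code_nth split: if_splits)
    qed
    have "h \<in> proper_codes n"
      using h hk assms(1)
      by (auto simp: proper_codes_def intro: exI[of _ "1::nat"] exI[of _ "0::nat"])
    then show "h \<in> proper_codes n - star_code n ` {..n}"
      using ne by blast
    show "code_adj n (star_code n 0) h"
      using assms(1) by (intro code_adjI[where i = 0] star_code_in_codes h ne)
        (auto simp: hk star_code_nth)
    have "max (star_code n n 0) (h 0) = 0"
      using assms(1) by (auto simp: hk star_code_nth)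
    then show "\<not> code_adj n (star_code n n) h"
      using assms(1) by (auto simp: code_adj_def prime_code_def intro!: exI[of _ "0::nat"])
  qed
  consider "0 < j \<and> j < n" | "0 < k \<and> k < n" | "j = 0 \<and> k = n" | "j = n \<and> k = 0"
    using assms by linarith
  then show ?thesis
  proof cases
    case 1
    then show ?thesis using interior[of j k] assms(4) by blast
  next
    case 2
    then show ?thesis using interior[of k j] assms(4) by blast
  next
    case 3
    then show ?thesis using ends by (intro bexI[of _ h]) simp_all
  next
    case 4
    then show ?thesis using ends by (intro bexI[of _ h]) simp_all
  qed
qed

section \<open>Ideals of a product of local rings\<close>

text \<open>The list product is an iterated binary product. Undoing the cons isomorphism and
  applying \<open>fst\<close>, or \<open>snd\<close> followed by a shorter projection, gives a
  homomorphism that agrees with list indexing on the carrier.\<close>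

lemma RDirProd_list_nth_hom:
  assumes "\<And>i. i < length Rs \<Longrightarrow> ring (Rs ! i)" and "i < length Rs"
  shows "(\<lambda>xs. xs ! i) \<in> ring_hom (RDirProd_list Rs) (Rs ! i)"
  using assms
proof (induction Rs arbitrary: i)
  case (Cons R Rs)
  let ?P = "RDirProd R (RDirProd_list Rs)"
  let ?cons = "\<lambda>(a, as). a # as"
  have iso: "?cons \<in> ring_iso ?P (RDirProd_list (R # Rs))"
    by (rule RDirProd_list_iso1)
  have "ring ?P"
    using Cons.prems(1)[of 0] Cons.prems(1)[of "Suc _"]
    by (intro RDirProd_ring RDirProd_list_is_ring) auto
  have ring_list: "ring (RDirProd_list (R # Rs))"
    using Cons.prems(1) by (rule RDirProd_list_is_ring)
  have inv: "inv_into (carrier ?P) ?cons \<in> ring_hom (RDirProd_list (R # Rs)) ?P"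
    using ring_iso_set_sym[OF \<open>ring ?P\<close> iso] by (simp add: ring_iso_def)
  have inv_eq: "inv_into (carrier ?P) ?cons xs = (hd xs, tl xs)"
    if "xs \<in> carrier (RDirProd_list (R # Rs))" for xs
  proof -
    have "xs = ?cons (hd xs, tl xs)" "(hd xs, tl xs) \<in> carrier ?P"
      using that by (auto simp: RDirProd_list_carrier RDirProd_carrier)
    then show ?thesis
      using inv_into_f_f[OF inj_on_RDirProd_carrier] by metis
  qed
  show ?case
  proof (cases i)
    case 0
    have "fst \<in> ring_hom ?P R"
      by (auto simp: ring_hom_def RDirProd_def DirProd_def monoid.defs)
    from ring_hom_trans[OF inv this] show ?thesis
      unfolding 0 nth_Cons_0 by (rule ring.ring_hom_restrict[OF ring_list])
        (auto simp: inv_eq RDirProd_list_carrier)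
  next
    case (Suc k)
    have "snd \<in> ring_hom ?P (RDirProd_list Rs)"
      by (auto simp: ring_hom_def RDirProd_def DirProd_def monoid.defs)
    moreover have "(\<lambda>xs. xs ! k) \<in> ring_hom (RDirProd_list Rs) (Rs ! k)"
      using Cons.IH[of k] Cons.prems(1)[of "Suc _"] Cons.prems(2) Suc by auto
    ultimately have "(\<lambda>xs. xs ! k) \<circ> (snd \<circ> inv_into (carrier ?P) ?cons)
        \<in> ring_hom (RDirProd_list (R # Rs)) (Rs ! k)"
      using inv by (intro ring_hom_trans)
    then show ?thesis
      unfolding Suc nth_Cons_Suc by (rule ring.ring_hom_restrict[OF ring_list])
        (auto simp: inv_eq RDirProd_list_carrier)
  qed
qed simp

text \<open>The maximal ideal of the local ring cannot be zero, since zero lies strictly below the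
  proper ideal \<open>M\<close>; so it is itself nontrivial and equals \<open>M\<close>.\<close>

lemma nontrivial_ideal_is_maximal:
  assumes "local_ring S" and "nontrivial_ideals S = {M}"
  shows "maximalideal M S"
proof -
  obtain N where N: "maximalideal N S" and "cring S"
    using assms(1) unfolding local_ring_def by blast
  interpret cring S by fact
  have M: "ideal M S" "M \<noteq> {\<zero>\<^bsub>S\<^esub>}" "M \<noteq> carrier S"
    using assms(2) by (auto simp: nontrivial_ideals_def)
  interpret M: ideal M S by (rule M(1))
  have "N \<noteq> {\<zero>\<^bsub>S\<^esub>}"
    using maximalideal.I_maximal[OF N M(1)] M M.zero_closed M.a_subset by auto
  then have "N \<in> nontrivial_ideals S"
    using maximalideal.axioms(1)[OF N] maximalideal.I_notcarr[OF N]
    by (auto simp: nontrivial_ideals_def)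
  then show ?thesis
    using N assms(2) by simp
qed

text \<open>Surjectivity gives absorption: every multiplier from \<open>S\<close> lifts to
  \<open>R\<close>.\<close>

lemma surj_image_ideal:
  assumes "ring_hom_ring R S h" and surj: "h ` carrier R = carrier S" and "ideal I R"
  shows "ideal (h ` I) S"
proof -
  interpret h: ring_hom_ring R S h by fact
  interpret I: ideal I R by fact
  show ?thesis
  proof (rule idealI[OF h.S.ring_axioms])
    show "subgroup (h ` I) (add_monoid S)"
    proof (rule h.S.add.subgroupI)
      show "h ` I \<subseteq> carrier S"
        using I.Icarr by auto
      show "h ` I \<noteq> {}"
        using I.zero_closed by blast
    next
      fix a assume "a \<in> h ` I"
      then obtain x where "x \<in> I" "a = h x" by blast
      then show "\<ominus>\<^bsub>S\<^esub> a \<in> h ` I"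
        using I.Icarr I.a_inv_closed by (intro image_eqI[of _ _ "\<ominus>\<^bsub>R\<^esub> x"]) auto
    next
      fix a b assume "a \<in> h ` I" "b \<in> h ` I"
      then obtain x y where "x \<in> I" "a = h x" "y \<in> I" "b = h y" by blast
      then show "a \<oplus>\<^bsub>S\<^esub> b \<in> h ` I"
        using I.Icarr I.a_closed by (intro image_eqI[of _ _ "x \<oplus>\<^bsub>R\<^esub> y"]) auto
    qed
  next
    fix a c assume "a \<in> h ` I" "c \<in> carrier S"
    then obtain x y where "x \<in> I" "a = h x" "y \<in> carrier R" "c = h y"
      using surj by blast
    then show "c \<otimes>\<^bsub>S\<^esub> a \<in> h ` I" "a \<otimes>\<^bsub>S\<^esub> c \<in> h ` I"
      using I.Icarr I.I_l_closed I.I_r_closed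
      by (auto intro: image_eqI[of _ _ "y \<otimes>\<^bsub>R\<^esub> x"] image_eqI[of _ _ "x \<otimes>\<^bsub>R\<^esub> y"])
  qed
qed

text \<open>If \<open>m \<noteq> 0\<close> lies in \<open>M\<close> and \<open>m\<^sup>2 \<noteq> 0\<close>, then \<open>(m\<^sup>2) = M\<close>,
  so \<open>m (1 - r m) = 0\<close> for some \<open>r\<close>.\<close>

lemma ex_zero_divisors:
  assumes "cring S" and "nontrivial_ideals S = {M}"
  obtains a b where "a \<in> carrier S" "b \<in> carrier S" "a \<noteq> \<zero>\<^bsub>S\<^esub>" "b \<noteq> \<zero>\<^bsub>S\<^esub>" "a \<otimes>\<^bsub>S\<^esub> b = \<zero>\<^bsub>S\<^esub>"
proof -
  interpret cring S by fact
  have M: "ideal M S" "M \<noteq> {\<zero>\<^bsub>S\<^esub>}" "M \<noteq> carrier S"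
    using assms(2) by (auto simp: nontrivial_ideals_def)
  interpret M: ideal M S by (rule M(1))
  obtain m where m: "m \<in> M" "m \<noteq> \<zero>\<^bsub>S\<^esub>"
    using M(2) M.zero_closed by blast
  have mc: "m \<in> carrier S"
    using m(1) by (rule M.Icarr)
  show ?thesis
  proof (cases "m \<otimes>\<^bsub>S\<^esub> m = \<zero>\<^bsub>S\<^esub>")
    case True
    then show ?thesis using that[OF mc mc m(2) m(2)] by blast
  next
    case False
    let ?J = "PIdl\<^bsub>S\<^esub> (m \<otimes>\<^bsub>S\<^esub> m)"
    have "m \<otimes>\<^bsub>S\<^esub> m \<in> M"
      using M.I_l_closed m(1) mc by blast
    then have "?J \<subseteq> M"
      using cgenideal_minimal M(1) by blast
    moreover have "m \<otimes>\<^bsub>S\<^esub> m \<in> ?J" "ideal ?J S"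
      using mc cgenideal_self cgenideal_ideal by auto
    ultimately have "?J \<in> nontrivial_ideals S"
      using False M(3) M.a_subset by (auto simp: nontrivial_ideals_def)
    then have "m \<in> ?J"
      using assms(2) m(1) by simp
    then obtain r where r: "r \<in> carrier S" "m = r \<otimes>\<^bsub>S\<^esub> (m \<otimes>\<^bsub>S\<^esub> m)"
      unfolding cgenideal_def by blast
    have rm: "r \<otimes>\<^bsub>S\<^esub> m \<in> M"
      using M.I_l_closed m(1) r(1) by blast
    let ?b = "\<one>\<^bsub>S\<^esub> \<ominus>\<^bsub>S\<^esub> r \<otimes>\<^bsub>S\<^esub> m"
    have "m \<otimes>\<^bsub>S\<^esub> ?b = m \<ominus>\<^bsub>S\<^esub> r \<otimes>\<^bsub>S\<^esub> (m \<otimes>\<^bsub>S\<^esub> m)"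
      using mc r(1) by algebra
    also have "\<dots> = \<zero>\<^bsub>S\<^esub>"
      using mc r(2) by (metis r_right_minus_eq)
    finally have "m \<otimes>\<^bsub>S\<^esub> ?b = \<zero>\<^bsub>S\<^esub>" .
    \<comment> \<open>Otherwise 1 would equal \<open>r\<close> times \<open>m\<close>, an element of
      the proper ideal \<open>M\<close>.\<close>
    moreover have "?b \<noteq> \<zero>\<^bsub>S\<^esub>"
      using rm M(3) M.one_imp_carrier M.Icarr[OF rm] by (metis one_closed r_right_minus_eq)
    ultimately show ?thesis
      using that[of m ?b] mc m(2) r(1) by auto
  qed
qed

text \<open>The product is described by its projections alone: they are jointly injective and
  realise every family of components. The ideal theory then never touches lists or the
  isomorphism.\<close>

locale local_product = cring R for R :: "('a, 'm) ring_scheme" (structure) +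
  fixes S :: "nat \<Rightarrow> ('b, 'k) ring_scheme" and n :: nat and pr :: "nat \<Rightarrow> 'a \<Rightarrow> 'b" and M :: "nat \<Rightarrow> 'b set"
  assumes local: "i < n \<Longrightarrow> local_ring (S i)"
    and nontrivial: "i < n \<Longrightarrow> nontrivial_ideals (S i) = {M i}"
    and pr_hom: "i < n \<Longrightarrow> pr i \<in> ring_hom R (S i)"
    and pr_inj: "\<lbrakk>x \<in> carrier R; y \<in> carrier R; \<And>i. i < n \<Longrightarrow> pr i x = pr i y\<rbrakk> \<Longrightarrow> x = y"
    and pr_surj: "(\<And>i. i < n \<Longrightarrow> z i \<in> carrier (S i)) \<Longrightarrow> \<exists>x\<in>carrier R. \<forall>i<n. pr i x = z i"
begin

lemma S_cring: "i < n \<Longrightarrow> cring (S i)"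
  using local by (simp add: local_ring_def)

lemma S_ring: "i < n \<Longrightarrow> ring (S i)"
  using S_cring by (rule cring.axioms(1))

lemma pr_ring_hom: "i < n \<Longrightarrow> ring_hom_ring R (S i) (pr i)"
  by (rule ring_hom_ringI2[OF ring_axioms S_ring pr_hom])

lemma pr_simps [simp]:
  assumes "i < n"
  shows "pr i \<zero> = \<zero>\<^bsub>S i\<^esub>" "pr i \<one> = \<one>\<^bsub>S i\<^esub>"
    and "x \<in> carrier R \<Longrightarrow> pr i x \<in> carrier (S i)"
    and "\<lbrakk>x \<in> carrier R; y \<in> carrier R\<rbrakk> \<Longrightarrow> pr i (x \<oplus>\<^bsub>R\<^esub> y) = pr i x \<oplus>\<^bsub>S i\<^esub> pr i y"
    and "\<lbrakk>x \<in> carrier R; y \<in> carrier R\<rbrakk> \<Longrightarrow> pr i (x \<otimes> y) = pr i x \<otimes>\<^bsub>S i\<^esub> pr i y"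
    and "x \<in> carrier R \<Longrightarrow> pr i (\<ominus> x) = \<ominus>\<^bsub>S i\<^esub> pr i x"
proof -
  interpret pr: ring_hom_ring R "S i" "pr i"
    by (rule pr_ring_hom[OF assms])
  show "pr i \<zero> = \<zero>\<^bsub>S i\<^esub>" "pr i \<one> = \<one>\<^bsub>S i\<^esub>"
    and "x \<in> carrier R \<Longrightarrow> pr i x \<in> carrier (S i)"
    and "\<lbrakk>x \<in> carrier R; y \<in> carrier R\<rbrakk> \<Longrightarrow> pr i (x \<oplus>\<^bsub>R\<^esub> y) = pr i x \<oplus>\<^bsub>S i\<^esub> pr i y"
    and "\<lbrakk>x \<in> carrier R; y \<in> carrier R\<rbrakk> \<Longrightarrow> pr i (x \<otimes> y) = pr i x \<otimes>\<^bsub>S i\<^esub> pr i y"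
    and "x \<in> carrier R \<Longrightarrow> pr i (\<ominus> x) = \<ominus>\<^bsub>S i\<^esub> pr i x"
    by auto
qed

text \<open>The chain of all ideals of one factor. Every number above 1 denotes the whole factor,
  hence the bounds by 2 wherever a level must determine its index.\<close>

definition level :: "nat \<Rightarrow> nat \<Rightarrow> 'b set" where
  "level i k = (if k = 0 then {\<zero>\<^bsub>S i\<^esub>} else if k = 1 then M i else carrier (S i))"

definition code_ideal :: "(nat \<Rightarrow> nat) \<Rightarrow> 'a set" where
  "code_ideal f = {x \<in> carrier R. \<forall>i<n. pr i x \<in> level i (f i)}"

lemma M_ideal:
  assumes "i < n"
  shows "ideal (M i) (S i)" "M i \<noteq> {\<zero>\<^bsub>S i\<^esub>}" "M i \<noteq> carrier (S i)"
  using nontrivial[OF assms] by (auto simp: nontrivial_ideals_def)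

lemma level_ideal: "i < n \<Longrightarrow> ideal (level i k) (S i)"
  using M_ideal ring.zeroideal[OF S_ring] ring.oneideal[OF S_ring] by (simp add: level_def)

lemma level_subset: "i < n \<Longrightarrow> level i k \<subseteq> carrier (S i)"
  using additive_subgroup.a_subset[OF ideal.axioms(1)[OF level_ideal]] .

lemma zero_in_level: "i < n \<Longrightarrow> \<zero>\<^bsub>S i\<^esub> \<in> level i k"
  using additive_subgroup.zero_closed[OF ideal.axioms(1)[OF level_ideal]] .

lemma level_mono: "\<lbrakk>i < n; k \<le> l\<rbrakk> \<Longrightarrow> level i k \<subseteq> level i l"
  using zero_in_level[of i l] zero_in_level[of i 1] level_subset[of i k]
  by (auto simp: level_def split: if_splits)

lemma carrier_neq_zero: "i < n \<Longrightarrow> carrier (S i) \<noteq> {\<zero>\<^bsub>S i\<^esub>}"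
  using M_ideal[of i] zero_in_level[of i 1] level_subset[of i 1] by (auto simp: level_def)

lemma level_inj: "\<lbrakk>i < n; k \<le> 2; l \<le> 2; level i k = level i l\<rbrakk> \<Longrightarrow> k = l"
  using M_ideal[of i] carrier_neq_zero[of i]
  by (cases "k = 0"; cases "k = 1"; cases "l = 0"; cases "l = 1") (auto simp: level_def)

lemma one_notin_level:
  assumes "i < n" "k < 2"
  shows "\<one>\<^bsub>S i\<^esub> \<notin> level i k"
proof
  assume "\<one>\<^bsub>S i\<^esub> \<in> level i k"
  then have "level i k = level i 2"
    using ideal.one_imp_carrier[OF level_ideal] assms(1) by (simp add: level_def)
  then show False
    using level_inj[of i k 2] assms by simp
qed

lemma ideal_level_cases:
  assumes "i < n" "ideal I (S i)"
  shows "\<exists>k\<le>2. I = level i k"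
proof (cases "I \<in> nontrivial_ideals (S i)")
  case True
  then show ?thesis
    using nontrivial[OF assms(1)] by (intro exI[of _ 1]) (simp add: level_def)
next
  case False
  then have "I = level i 0 \<or> I = level i 2"
    using assms by (auto simp: nontrivial_ideals_def level_def)
  then show ?thesis by auto
qed

lemma pr_choose:
  assumes "\<And>i. i < n \<Longrightarrow> z i \<in> carrier (S i)"
  obtains x where "x \<in> carrier R" "\<And>i. i < n \<Longrightarrow> pr i x = z i"
  using pr_surj[of z] assms by blast

lemma pr_single:
  assumes "a \<in> carrier (S i)" "i < n"
  obtains x where "x \<in> carrier R" "\<And>j. j < n \<Longrightarrow> pr j x = (if j = i then a else \<zero>\<^bsub>S j\<^esub>)"
proof -
  have "(if j = i then a else \<zero>\<^bsub>S j\<^esub>) \<in> carrier (S j)" if "j < n" for j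
    using that assms(1) ring.ring_simprules(2)[OF S_ring] by simp
  from pr_choose[of "\<lambda>j. if j = i then a else \<zero>\<^bsub>S j\<^esub>", OF this] show ?thesis
    using that by blast
qed

lemma pr_mask:
  assumes "x \<in> carrier R"
  obtains y where "y \<in> carrier R" "\<And>i. i < n \<Longrightarrow> pr i y = (if P i then pr i x else \<zero>\<^bsub>S i\<^esub>)"
proof -
  have "(if P i then pr i x else \<zero>\<^bsub>S i\<^esub>) \<in> carrier (S i)" if "i < n" for i
    using that assms ring.ring_simprules(2)[OF S_ring] by simp
  from pr_choose[of "\<lambda>i. if P i then pr i x else \<zero>\<^bsub>S i\<^esub>", OF this] show ?thesis
    using that by blast
qed

lemma level_closed:
  assumes "i < n"
  shows "\<lbrakk>a \<in> level i k; b \<in> level i k\<rbrakk> \<Longrightarrow> a \<oplus>\<^bsub>S i\<^esub> b \<in> level i k"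
    and "a \<in> level i k \<Longrightarrow> \<ominus>\<^bsub>S i\<^esub> a \<in> level i k"
    and "\<lbrakk>a \<in> level i k; b \<in> carrier (S i)\<rbrakk> \<Longrightarrow> a \<otimes>\<^bsub>S i\<^esub> b \<in> level i k"
    and "\<lbrakk>a \<in> level i k; b \<in> carrier (S i)\<rbrakk> \<Longrightarrow> b \<otimes>\<^bsub>S i\<^esub> a \<in> level i k"
proof -
  interpret L: ideal "level i k" "S i"
    by (rule level_ideal[OF assms])
  show "\<lbrakk>a \<in> level i k; b \<in> level i k\<rbrakk> \<Longrightarrow> a \<oplus>\<^bsub>S i\<^esub> b \<in> level i k"
    and "a \<in> level i k \<Longrightarrow> \<ominus>\<^bsub>S i\<^esub> a \<in> level i k"
    and "\<lbrakk>a \<in> level i k; b \<in> carrier (S i)\<rbrakk> \<Longrightarrow> a \<otimes>\<^bsub>S i\<^esub> b \<in> level i k"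
    and "\<lbrakk>a \<in> level i k; b \<in> carrier (S i)\<rbrakk> \<Longrightarrow> b \<otimes>\<^bsub>S i\<^esub> a \<in> level i k"
    using L.a_closed L.a_inv_closed L.I_r_closed L.I_l_closed by auto
qed

lemma code_ideal_is_ideal: "ideal (code_ideal f) R"
proof (rule idealI[OF ring_axioms])
  show "subgroup (code_ideal f) (add_monoid R)"
    by (rule add.subgroupI)
      (auto simp: code_ideal_def level_closed intro!: zero_in_level exI[of _ \<zero>] simp flip: a_inv_def)
qed (auto simp: code_ideal_def level_closed)

text \<open>A component in its level extends by zero to an element of the ideal. The vector can
  therefore be read off from the ideal's projections.\<close>

lemma pr_image_code_ideal:
  assumes "i < n"
  shows "pr i ` code_ideal f = level i (f i)"
proof (intro equalityI subsetI)
  fix y assume y: "y \<in> level i (f i)"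
  define z where "z j = (if j = i then y else \<zero>\<^bsub>S j\<^esub>)" for j
  have z: "z j \<in> level j (f j)" if "j < n" for j
    using that y zero_in_level by (auto simp: z_def)
  then obtain x where "x \<in> carrier R" "\<And>j. j < n \<Longrightarrow> pr j x = z j"
    using pr_choose[of z] level_subset by blast
  then show "y \<in> pr i ` code_ideal f"
    using assms z by (intro image_eqI[of _ _ x]) (auto simp: code_ideal_def z_def)
qed (use assms in \<open>auto simp: code_ideal_def\<close>)

text \<open>The ideals of a factor form a chain, so the sum of two levels is the larger one. To
  split an element, each component goes entirely to the summand with the larger level.\<close>

lemma code_ideal_add: "code_ideal f <+>\<^bsub>R\<^esub> code_ideal g = code_ideal (\<lambda>i. max (f i) (g i))"
proof (intro equalityI subsetI)
  fix x assume "x \<in> code_ideal f <+>\<^bsub>R\<^esub> code_ideal g"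
  then obtain y z where "y \<in> code_ideal f" "z \<in> code_ideal g" "x = y \<oplus>\<^bsub>R\<^esub> z"
    unfolding set_add_def' by blast
  moreover have "level i (f i) \<subseteq> level i (max (f i) (g i))"
    "level i (g i) \<subseteq> level i (max (f i) (g i))" if "i < n" for i
    using that using level_mono[OF that, of "f i" "max (f i) (g i)"]
      level_mono[OF that, of "g i" "max (f i) (g i)"] by simp_all
  ultimately show "x \<in> code_ideal (\<lambda>i. max (f i) (g i))"
    unfolding code_ideal_def using level_closed(1) by (simp add: subset_iff)
next
  fix x assume x: "x \<in> code_ideal (\<lambda>i. max (f i) (g i))"
  then have xc: "x \<in> carrier R"
    by (simp add: code_ideal_def)
  obtain y where y: "y \<in> carrier R" "\<And>i. i < n \<Longrightarrow> pr i y = (if g i \<le> f i then pr i x else \<zero>\<^bsub>S i\<^esub>)"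
    using pr_mask[OF xc, of "\<lambda>i. g i \<le> f i"] by blast
  obtain z where z: "z \<in> carrier R" "\<And>i. i < n \<Longrightarrow> pr i z = (if \<not> g i \<le> f i then pr i x else \<zero>\<^bsub>S i\<^esub>)"
    using pr_mask[OF xc, of "\<lambda>i. \<not> g i \<le> f i"] by blast
  have "x = y \<oplus>\<^bsub>R\<^esub> z"
  proof (rule pr_inj)
    fix i assume i: "i < n"
    interpret Si: cring "S i" by (rule S_cring[OF i])
    show "pr i x = pr i (y \<oplus>\<^bsub>R\<^esub> z)"
      using y(2)[OF i] z(2)[OF i] xc y(1) z(1) i by simp
  qed (use xc y(1) z(1) in simp_all)
  moreover have level: "pr i x \<in> level i (max (f i) (g i))" if "i < n" for i
    using x that by (simp add: code_ideal_def)
  then have "pr i x \<in> level i (f i)" if "i < n" "g i \<le> f i" for i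
    using that level[of i] by (simp add: max_def split: if_splits)
  then have "y \<in> code_ideal f"
    using y by (auto simp: code_ideal_def zero_in_level)
  moreover have "pr i x \<in> level i (g i)" if "i < n" "\<not> g i \<le> f i" for i
    using that level[of i] by (simp add: max_def)
  then have "z \<in> code_ideal g"
    using z by (auto simp: code_ideal_def zero_in_level)
  ultimately show "x \<in> code_ideal f <+>\<^bsub>R\<^esub> code_ideal g"
    unfolding set_add_def' by blast
qed

text \<open>With orthogonal idempotents \<open>e i\<close>, an element whose components agree with those of elements
  \<open>y i\<close> of an ideal is the sum of the \<open>e i \<otimes> y i\<close>; the induction builds the partial sums.\<close>

lemma ideal_componentwise:
  assumes I: "ideal I R" and x: "x \<in> carrier R" "\<And>i. i < n \<Longrightarrow> pr i x \<in> pr i ` I"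
  shows "x \<in> I"
proof -
  interpret I: ideal I R by (rule I)
  have "\<exists>w\<in>I. \<forall>i<n. pr i w = (if i < k then pr i x else \<zero>\<^bsub>S i\<^esub>)" if "k \<le> n" for k
    using that
  proof (induction k)
    case 0
    then show ?case
      by (intro bexI[of _ \<zero>]) (auto simp: I.zero_closed)
  next
    case (Suc k)
    then obtain w where w: "w \<in> I" "\<And>i. i < n \<Longrightarrow> pr i w = (if i < k then pr i x else \<zero>\<^bsub>S i\<^esub>)"
      by auto
    obtain y where y: "y \<in> I" "pr k x = pr k y"
      using x(2)[of k] Suc.prems by (auto simp: image_iff)
    have k: "k < n"
      using Suc.prems by simp
    obtain e where e: "e \<in> carrier R"
      "\<And>i. i < n \<Longrightarrow> pr i e = (if i = k then \<one>\<^bsub>S k\<^esub> else \<zero>\<^bsub>S i\<^esub>)"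
      using pr_single[OF ring.ring_simprules(6)[OF S_ring[OF k]] k] by blast
    have yw: "y \<in> carrier R" "w \<in> carrier R" "e \<otimes> y \<in> carrier R"
      using y(1) w(1) e(1) I.Icarr by auto
    have "w \<oplus>\<^bsub>R\<^esub> e \<otimes> y \<in> I"
      using w(1) y(1) e(1) by (simp add: I.a_closed I.I_l_closed)
    moreover have "pr i (w \<oplus>\<^bsub>R\<^esub> e \<otimes> y) = (if i < Suc k then pr i x else \<zero>\<^bsub>S i\<^esub>)" if i: "i < n" for i
    proof -
      interpret Si: cring "S i" by (rule S_cring[OF i])
      have c: "pr i x \<in> carrier (S i)" "pr i y \<in> carrier (S i)"
        using i x(1) yw by auto
      have eq: "pr i (w \<oplus>\<^bsub>R\<^esub> e \<otimes> y) = pr i w \<oplus>\<^bsub>S i\<^esub> pr i e \<otimes>\<^bsub>S i\<^esub> pr i y"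
        using i e(1) yw by simp
      show ?thesis
      proof (cases "i = k")
        case True
        then have wey: "pr i w = \<zero>\<^bsub>S i\<^esub>" "pr i e = \<one>\<^bsub>S i\<^esub>" "pr i y = pr i x"
          using w(2)[OF i] e(2)[OF i] y(2) by simp_all
        have "pr i (w \<oplus>\<^bsub>R\<^esub> e \<otimes> y) = pr i x"
          unfolding eq wey using c(1) by simp
        then show ?thesis
          using True by simp
      next
        case False
        then have "pr i e = \<zero>\<^bsub>S i\<^esub>"
          using e(2)[OF i] by simp
        then show ?thesis
          unfolding eq w(2)[OF i] using c False by (simp add: less_Suc_eq)
      qed
    qed
    ultimately show ?case by blast
  qed
  from this[of n] obtain w where w: "w \<in> I" "\<And>i. i < n \<Longrightarrow> pr i w = pr i x"
    by auto
  have "w = x"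
    using w I.Icarr x(1) by (intro pr_inj) blast+
  then show ?thesis using w(1) by simp
qed

lemma ideal_eq_code_ideal:
  assumes I: "ideal I R"
  shows "\<exists>f. (\<forall>i<n. f i \<le> 2) \<and> I = code_ideal f"
proof -
  interpret I: ideal I R by (rule I)
  have "\<exists>k\<le>2. pr i ` I = level i k" if "i < n" for i
  proof -
    \<comment> \<open>The carrier is the ideal of the constant vector 2, so surjectivity of the
      projection is an instance of the image formula.\<close>
    have "pr i ` carrier R = carrier (S i)"
      using pr_image_code_ideal[OF that, of "\<lambda>_. 2"] level_subset
      by (auto simp: code_ideal_def level_def that)
    then have "ideal (pr i ` I) (S i)"
      using surj_image_ideal[OF pr_ring_hom[OF that] _ I] by blast
    then show ?thesis
      using ideal_level_cases[OF that] by blast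
  qed
  then obtain f where f: "\<And>i. i < n \<Longrightarrow> f i \<le> 2 \<and> pr i ` I = level i (f i)"
    by metis
  have "I = code_ideal f"
  proof (intro equalityI subsetI)
    fix x assume "x \<in> I"
    then show "x \<in> code_ideal f"
      using f I.Icarr by (auto simp: code_ideal_def)
  next
    fix x assume "x \<in> code_ideal f"
    then show "x \<in> I"
      using f ideal_componentwise[OF I, of x] by (auto simp: code_ideal_def)
  qed
  then show ?thesis
    using f by blast
qed

lemma code_ideal_eq_iff:
  assumes "\<And>i. i < n \<Longrightarrow> f i \<le> 2" "\<And>i. i < n \<Longrightarrow> g i \<le> 2"
  shows "code_ideal f = code_ideal g \<longleftrightarrow> (\<forall>i<n. f i = g i)"
proof
  assume "code_ideal f = code_ideal g"
  then have "level i (f i) = level i (g i)" if "i < n" for i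
    using pr_image_code_ideal[OF that] by metis
  then show "\<forall>i<n. f i = g i"
    using assms level_inj by blast
qed (simp add: code_ideal_def)

lemma code_ideal_zero: "code_ideal (\<lambda>_. 0) = {\<zero>}"
  using pr_inj[of _ \<zero>] by (auto simp: code_ideal_def level_def)

lemma code_ideal_carrier: "code_ideal (\<lambda>_. 2) = carrier R"
  by (auto simp: code_ideal_def level_def)

lemma nontrivial_ideals_eq: "nontrivial_ideals R = code_ideal ` proper_codes n"
proof -
  have iff: "code_ideal f \<in> nontrivial_ideals R \<longleftrightarrow> f \<in> proper_codes n" if f: "f \<in> codes n" for f
  proof -
    have "code_ideal f = {\<zero>} \<longleftrightarrow> (\<forall>i<n. f i = 0)" "code_ideal f = carrier R \<longleftrightarrow> (\<forall>i<n. f i = 2)"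
      using code_ideal_eq_iff[of f "\<lambda>_. 0"] code_ideal_eq_iff[of f "\<lambda>_. 2"] codes_le[OF f]
      unfolding code_ideal_zero code_ideal_carrier by simp_all
    then show ?thesis
      using f by (simp add: nontrivial_ideals_def code_ideal_is_ideal proper_codes_def)
  qed
  have "\<exists>f\<in>codes n. I = code_ideal f" if I: "I \<in> nontrivial_ideals R" for I
  proof -
    obtain f where f: "\<forall>i<n. f i \<le> 2" "I = code_ideal f"
      using ideal_eq_code_ideal[of I] I unfolding nontrivial_ideals_def by blast
    \<comment> \<open>The vector found is arbitrary from \<open>n\<close> on; \<open>mk_code\<close>
      replaces it by its extensional representative.\<close>
    moreover have "code_ideal f = code_ideal (mk_code n f)"
      by (simp add: code_ideal_def)
    ultimately show ?thesis
      using mk_code_in_codes[of n f] by blast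
  qed
  moreover have "f \<in> codes n" if "f \<in> proper_codes n" for f
    using that by (simp add: proper_codes_def)
  ultimately show ?thesis
    using iff by blast
qed

lemma inj_on_code_ideal: "inj_on code_ideal (codes n)"
proof (rule inj_onI)
  fix f g assume fg: "f \<in> codes n" "g \<in> codes n" "code_ideal f = code_ideal g"
  then have "\<forall>i<n. f i = g i"
    using code_ideal_eq_iff[of f g] codes_le by blast
  then show "f = g"
    using codes_eqI[OF fg(1,2)] by blast
qed

lemma M_prime: "i < n \<Longrightarrow> primeideal (M i) (S i)"
  using cring.maximalideal_prime[OF S_cring nontrivial_ideal_is_maximal[OF local nontrivial]] .

text \<open>With one entry 1 and all others 2 the ideal is the preimage of the prime ideal
  \<open>M i\<close>. Conversely, two deficit coordinates are refuted by orthogonal idempotents and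
  an entry 0 by zero divisors of that factor; both are pairs with product zero outside the
  ideal.\<close>

lemma prime_code_ideal_iff:
  assumes f: "\<And>i. i < n \<Longrightarrow> f i \<le> 2"
  shows "primeideal (code_ideal f) R \<longleftrightarrow> prime_code n f"
proof
  assume "prime_code n f"
  then obtain i where i: "i < n" "f i = 1" "\<And>j. j < n \<Longrightarrow> j \<noteq> i \<Longrightarrow> f j = 2"
    by (auto simp: prime_code_def)
  have mem: "x \<in> code_ideal f \<longleftrightarrow> x \<in> carrier R \<and> pr i x \<in> M i" for x
  proof -
    have "pr j x \<in> level j (f j)" if "x \<in> carrier R" "pr i x \<in> M i" "j < n" for j
      using that i by (cases "j = i") (simp_all add: level_def)
    moreover have "level i (f i) = M i"
      using i(2) by (simp add: level_def)
    ultimately show ?thesis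
      using i(1) unfolding code_ideal_def by blast
  qed
  show "primeideal (code_ideal f) R"
  proof (rule primeidealI[OF code_ideal_is_ideal is_cring])
    have "\<one> \<notin> code_ideal f"
      using mem[of \<one>] one_notin_level[of i 1] i(1) by (simp add: level_def)
    then show "carrier R \<noteq> code_ideal f"
      by blast
    show "x \<in> code_ideal f \<or> y \<in> code_ideal f"
      if "x \<in> carrier R" "y \<in> carrier R" "x \<otimes> y \<in> code_ideal f" for x y
      using that mem primeideal.I_prime[OF M_prime[OF i(1)], of "pr i x" "pr i y"] i(1) by auto
  qed
next
  assume prime: "primeideal (code_ideal f) R"
  have prod: "x \<in> code_ideal f \<or> y \<in> code_ideal f"
    if "x \<in> carrier R" "y \<in> carrier R" "\<And>i. i < n \<Longrightarrow> pr i x \<otimes>\<^bsub>S i\<^esub> pr i y = \<zero>\<^bsub>S i\<^esub>" for x y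
  proof -
    have "x \<otimes> y \<in> code_ideal f"
      using that by (simp add: code_ideal_def zero_in_level)
    then show ?thesis
      using primeideal.I_prime[OF prime] that(1,2) by blast
  qed
  have "code_ideal f \<noteq> code_ideal (\<lambda>_. 2)"
    using primeideal.I_notcarr[OF prime] code_ideal_carrier by simp
  then obtain i where i: "i < n" "f i \<noteq> 2"
    using code_ideal_eq_iff[of f "\<lambda>_. 2"] f by auto
  have "f j = 2" if j: "j < n" "j \<noteq> i" for j
  proof (rule ccontr)
    assume "f j \<noteq> 2"
    obtain x where x: "x \<in> carrier R" "\<And>k. k < n \<Longrightarrow> pr k x = (if k = i then \<one>\<^bsub>S i\<^esub> else \<zero>\<^bsub>S k\<^esub>)"
      using pr_single[OF ring.ring_simprules(6)[OF S_ring[OF i(1)]] i(1)] by blast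
    obtain y where y: "y \<in> carrier R" "\<And>k. k < n \<Longrightarrow> pr k y = (if k = j then \<one>\<^bsub>S j\<^esub> else \<zero>\<^bsub>S k\<^esub>)"
      using pr_single[OF ring.ring_simprules(6)[OF S_ring[OF j(1)]] j(1)] by blast
    have "pr k x \<otimes>\<^bsub>S k\<^esub> pr k y = \<zero>\<^bsub>S k\<^esub>" if k: "k < n" for k
    proof -
      interpret Sk: cring "S k" by (rule S_cring[OF k])
      have "pr k x = \<zero>\<^bsub>S k\<^esub> \<or> pr k y = \<zero>\<^bsub>S k\<^esub>"
        using x(2)[OF k] y(2)[OF k] j(2) by auto
      then show ?thesis
        using pr_simps(3)[OF k x(1)] pr_simps(3)[OF k y(1)] by auto
    qed
    then consider "x \<in> code_ideal f" | "y \<in> code_ideal f"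
      using prod x(1) y(1) by blast
    then have "\<one>\<^bsub>S i\<^esub> \<in> level i (f i) \<or> \<one>\<^bsub>S j\<^esub> \<in> level j (f j)"
      using x(2)[OF i(1)] y(2)[OF j(1)] i(1) j(1) by cases (auto simp: code_ideal_def)
    then show False
      using one_notin_level f[OF i(1)] f[OF j(1)] i j \<open>f j \<noteq> 2\<close> by (metis le_neq_implies_less)
  qed
  moreover have "f i \<noteq> 0"
  proof
    assume "f i = 0"
    obtain a b where ab: "a \<in> carrier (S i)" "b \<in> carrier (S i)" "a \<noteq> \<zero>\<^bsub>S i\<^esub>" "b \<noteq> \<zero>\<^bsub>S i\<^esub>"
      "a \<otimes>\<^bsub>S i\<^esub> b = \<zero>\<^bsub>S i\<^esub>"
      using ex_zero_divisors[OF S_cring nontrivial] i(1) by blast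
    obtain x where x: "x \<in> carrier R" "\<And>k. k < n \<Longrightarrow> pr k x = (if k = i then a else \<zero>\<^bsub>S k\<^esub>)"
      using pr_single[OF ab(1) i(1)] by blast
    obtain y where y: "y \<in> carrier R" "\<And>k. k < n \<Longrightarrow> pr k y = (if k = i then b else \<zero>\<^bsub>S k\<^esub>)"
      using pr_single[OF ab(2) i(1)] by blast
    have "pr k x \<otimes>\<^bsub>S k\<^esub> pr k y = \<zero>\<^bsub>S k\<^esub>" if k: "k < n" for k
    proof -
      interpret Sk: cring "S k" by (rule S_cring[OF k])
      show ?thesis
        using x(2)[OF k] y(2)[OF k] ab(5) by (cases "k = i") simp_all
    qed
    then consider "x \<in> code_ideal f" | "y \<in> code_ideal f"
      using prod x(1) y(1) by blast
    then show False
      using x(2)[OF i(1)] y(2)[OF i(1)] i(1) ab(3,4) \<open>f i = 0\<close>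
      by cases (auto simp: code_ideal_def level_def)
  qed
  then have "f i = 1"
    using f[OF i(1)] i(2) by simp
  ultimately show "prime_code n f"
    using i(1) by (auto simp: prime_code_def)
qed

section \<open>The prime ideal sum graph of the product\<close>

abbreviation G :: "('a set, 'a set \<times> 'a set) pre_digraph" where
  "G \<equiv> with_proj (PIS R)"

lemma verts_PIS: "verts G = code_ideal ` proper_codes n"
  by (simp add: PIS_def nontrivial_ideals_eq)

lemma arcs_PIS_iff:
  assumes "f \<in> proper_codes n" "g \<in> proper_codes n"
  shows "(code_ideal f, code_ideal g) \<in> arcs_ends G \<longleftrightarrow> code_adj n f g"
proof -
  have fg: "f \<in> codes n" "g \<in> codes n"
    using assms by (auto simp: proper_codes_def)
  have "code_ideal f = code_ideal g \<longleftrightarrow> f = g"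
    using inj_on_eq_iff[OF inj_on_code_ideal fg] .
  moreover have "primeideal (code_ideal f <+>\<^bsub>R\<^esub> code_ideal g) R
      \<longleftrightarrow> prime_code n (\<lambda>i. max (f i) (g i))"
    unfolding code_ideal_add
    by (rule prime_code_ideal_iff) (use codes_le[OF fg(1)] codes_le[OF fg(2)] in simp)
  ultimately show ?thesis
    using assms by (simp add: PIS_def nontrivial_ideals_eq code_adj_def)
qed

lemma diameter_two_PIS:
  assumes "n \<ge> 2"
  shows "diameter_two G"
proof
  show "finite (verts G)"
    unfolding verts_PIS using finite_codes[of n] by (simp add: proper_codes_def)
next
  fix I J assume IJ: "(I, J) \<in> arcs_ends G"
  then have "I \<in> verts G" "J \<in> verts G"
    by (auto simp: PIS_def)
  then obtain f g where "f \<in> proper_codes n" "I = code_ideal f" "g \<in> proper_codes n" "J = code_ideal g"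
    unfolding verts_PIS by blast
  then show "(J, I) \<in> arcs_ends G"
    using IJ arcs_PIS_iff code_adj_sym by blast
next
  fix I J assume IJ: "I \<in> verts G" "J \<in> verts G" "I \<noteq> J" "(I, J) \<notin> arcs_ends G"
  then obtain f g where fg: "f \<in> proper_codes n" "I = code_ideal f" "g \<in> proper_codes n" "J = code_ideal g"
    unfolding verts_PIS by blast
  then have "f \<noteq> g" "\<not> code_adj n f g"
    using IJ arcs_PIS_iff by blast+
  then obtain h where "h \<in> proper_codes n" "code_adj n f h" "code_adj n h g"
    using code_common_neighbour[OF assms fg(1,3)] by blast
  then show "\<exists>K\<in>verts G. (I, K) \<in> arcs_ends G \<and> (K, J) \<in> arcs_ends G"
    unfolding fg(2,4) verts_PIS using arcs_PIS_iff fg(1,3) by blast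
qed

lemma sdim_PIS:
  assumes "n \<ge> 2"
  shows "int (sdim G) = 3 ^ n - int n - 3"
proof -
  interpret diameter_two G
    by (rule diameter_two_PIS[OF assms])
  let ?C = "code_ideal ` star_code n ` {..n}"
  have inj: "inj_on code_ideal (proper_codes n)"
    using inj_on_code_ideal by (rule inj_on_subset) (auto simp: proper_codes_def)
  have star: "star_code n ` {..n} \<subseteq> proper_codes n"
    using star_code_proper[OF assms] by blast
  have "inj_on (star_code n) {..n}"
    using star_code_neq[OF assms] by (intro inj_onI) auto
  then have cardC: "card ?C = n + 1"
    using card_image inj_on_subset[OF inj star] by (metis card_atMost Suc_eq_plus1)
  have C: "?C \<subseteq> verts G"
    unfolding verts_PIS using star by (rule image_mono)
  have "sdim G = card (verts G) - card ?C"
  proof (rule sdim_eq)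
    show "clique ?C"
      unfolding clique_def
    proof (intro conjI C ballI impI)
      fix I J assume IJ: "I \<in> ?C" "J \<in> ?C" "I \<noteq> J"
      then obtain j k where "j \<le> n" "I = code_ideal (star_code n j)"
        "k \<le> n" "J = code_ideal (star_code n k)"
        by auto
      then show "(I, J) \<in> arcs_ends G"
        using IJ(3) star_code_adj[OF assms, of j k] arcs_PIS_iff star_code_proper[OF assms] by blast
    qed
  next
    fix K assume "clique K"
    then have K: "K \<subseteq> code_ideal ` proper_codes n"
      "\<And>I J. \<lbrakk>I \<in> K; J \<in> K; I \<noteq> J\<rbrakk> \<Longrightarrow> (I, J) \<in> arcs_ends G"
      unfolding clique_def verts_PIS by blast+
    obtain L where L: "L \<subseteq> proper_codes n" "K = code_ideal ` L"
      using K(1) by (rule subset_imageE)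
    have "code_adj n f g" if "f \<in> L" "g \<in> L" "f \<noteq> g" for f g
    proof -
      have fg: "f \<in> proper_codes n" "g \<in> proper_codes n"
        using that L(1) by blast+
      then have "code_ideal f \<noteq> code_ideal g"
        using inj_on_eq_iff[OF inj] that(3) by blast
      then show ?thesis
        using K(2) that L(2) arcs_PIS_iff[OF fg] by blast
    qed
    then have "card L \<le> n + 1"
      by (rule code_clique_bound[OF L(1)])
    moreover have "card K = card L"
      unfolding L(2) by (rule card_image[OF inj_on_subset[OF inj L(1)]])
    ultimately show "card K \<le> card ?C"
      using cardC by simp
  next
    fix I J assume IJ: "I \<in> ?C" "J \<in> ?C" "I \<noteq> J"
    then obtain j k where jk: "j \<le> n" "I = code_ideal (star_code n j)"
      "k \<le> n" "J = code_ideal (star_code n k)"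
      by auto
    then have "j \<noteq> k"
      using IJ(3) by blast
    then obtain h where h: "h \<in> proper_codes n" "h \<notin> star_code n ` {..n}"
      "code_adj n (star_code n j) h \<longleftrightarrow> \<not> code_adj n (star_code n k) h"
      using star_code_separated[OF assms jk(1,3)] by blast
    have "code_ideal h \<notin> ?C"
      using inj_on_image_mem_iff[OF inj h(1) star] h(2) by blast
    then have "code_ideal h \<in> verts G - ?C"
      unfolding verts_PIS using h(1) by blast
    then show "\<exists>w\<in>verts G - ?C. (I, w) \<in> arcs_ends G \<longleftrightarrow> (J, w) \<notin> arcs_ends G"
      unfolding jk(2,4) using h(1,3) arcs_PIS_iff star_code_proper[OF assms] by blast
  qed
  moreover have "card (verts G) = 3 ^ n - 2"
    unfolding verts_PIS card_image[OF inj] using card_proper_codes assms by simp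
  \<comment> \<open>Makes the natural-number subtraction in \<open>sdim_eq\<close> exact, so that it
    transfers to the integers.\<close>
  moreover have "card ?C \<le> card (verts G)"
    using C finite_verts by (rule card_mono[rotated])
  ultimately show ?thesis
    unfolding cardC by (simp add: of_nat_diff)
qed

end

theorem theorem4p3:
  fixes R :: "('a, 'm) ring_scheme"
    and Rs :: "('b, 'k) ring_scheme list"
    and M :: "nat \<Rightarrow> 'b set"
    and n :: nat
  assumes "cring R"
    and "n \<ge> 2"
    and "length Rs = n"
    and "\<And>i. i < n \<Longrightarrow> local_ring (Rs ! i)"
    and "\<And>i. i < n \<Longrightarrow> nontrivial_ideals (Rs ! i) = {M i}"
    and "R \<simeq> RDirProd_list Rs"
  shows "int (sdim (with_proj (PIS R))) = 3 ^ n - int n - 3"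
proof -
  interpret cring R by fact
  obtain h where h: "h \<in> ring_iso R (RDirProd_list Rs)"
    using assms(6) by (auto simp: is_ring_iso_def)
  have bij: "bij_betw h (carrier R) (carrier (RDirProd_list Rs))"
    using ring_iso_memE(5)[OF h] .
  have Rs_ring: "ring (Rs ! i)" if "i < length Rs" for i
    using assms(3,4) that cring.axioms(1) unfolding local_ring_def by blast
  \<comment> \<open>The projections are the list entries of the image under the isomorphism
    \<open>h\<close>; bijectivity of \<open>h\<close> supplies joint injectivity and the realisation
    of families.\<close>
  interpret local_product R "\<lambda>i. Rs ! i" n "\<lambda>i x. h x ! i" M
  proof
    show "local_ring (Rs ! i)" "nontrivial_ideals (Rs ! i) = {M i}" if "i < n" for i
      using assms(4,5) that by auto
    show "(\<lambda>x. h x ! i) \<in> ring_hom R (Rs ! i)" if "i < n" for i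
      using ring_hom_trans[of h R "RDirProd_list Rs" "\<lambda>xs. xs ! i" "Rs ! i"]
        RDirProd_list_nth_hom[OF Rs_ring] h assms(3) that
      by (simp add: ring_iso_def comp_def)
    show "x = y" if xy: "x \<in> carrier R" "y \<in> carrier R" "\<And>i. i < n \<Longrightarrow> h x ! i = h y ! i" for x y
    proof -
      have "h x \<in> carrier (RDirProd_list Rs)" "h y \<in> carrier (RDirProd_list Rs)"
        using bij xy(1,2) by (auto dest: bij_betwE)
      then have "length (h x) = n" "length (h y) = n"
        using RDirProd_list_carrier_mem(1) assms(3) by blast+
      then have "h x = h y"
        using xy(3) by (simp add: list_eq_iff_nth_eq)
      then show ?thesis
        using bij xy(1,2) by (auto simp: bij_betw_def dest: inj_onD)
    qed
    show "\<exists>x\<in>carrier R. \<forall>i<n. h x ! i = z i" if z: "\<And>i. i < n \<Longrightarrow> z i \<in> carrier (Rs ! i)" for z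
    proof -
      have "map z [0..<n] \<in> carrier (RDirProd_list Rs)"
        using z assms(3) by (intro RDirProd_list_carrier_memI) auto
      then obtain x where "x \<in> carrier R" "h x = map z [0..<n]"
        using bij unfolding bij_betw_def by (metis imageE)
      then show ?thesis by (intro bexI[of _ x]) simp_all
    qed
  qed
  show ?thesis
    by (rule sdim_PIS[OF assms(2)])
qed

end
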